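(* Let $\mathbf{L}=\langle L,\leq\rangle$ be a complete lattice and $S$ an $L$-parameterization. A system $\mathcal{S}\subseteq L$ is an $S$-closure system in $\mathbf{L}$ if and only if for every $a\in L$, $$\bigwedge\{h(b);\ a\leq h(b),\ b\in\mathcal{S},\ \langle f,h\rangle\in S\}\in\mathcal{S}.$$
   Context: An isotone Galois connection in $\mathbf{L}$ is a pair $\langle f,h\rangle$ of maps $L\to L$ with $f(a)\leq b$ iff $a\leq h(b)$. An $L$-parameterization is a set $S$ of isotone Galois connections containing $\langle\mathrm{id},\mathrm{id}\rangle$. A closure system in $\mathbf{L}$ is a subset of $L$ closed under arbitrary infima (including the empty infimum $1$). An $S$-closure system is a closure system $\mathcal{S}$ in $\mathbf{L}$ such that $h(a)\in\mathcal{S}$ for all $\langle f,h\rangle\in S$ and all $a\in\mathcal{S}$. *)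

theory Defs
  imports Main
begin

definition isotone_galois_connection :: "('a::complete_lattice \<Rightarrow> 'a) \<times> ('a \<Rightarrow> 'a) \<Rightarrow> bool" where
  "isotone_galois_connection = (\<lambda>(f, h). \<forall>a b. f a \<le> b \<longleftrightarrow> a \<le> h b)"

definition L_parameterization :: "(('a::complete_lattice \<Rightarrow> 'a) \<times> ('a \<Rightarrow> 'a)) set \<Rightarrow> bool" where
  "L_parameterization S \<longleftrightarrow> (\<forall>p\<in>S. isotone_galois_connection p) \<and> (id, id) \<in> S"

text \<open>The case \<open>A = {}\<close> is included, so every closure system contains \<open>top\<close>.\<close>

definition closure_system :: "'a::complete_lattice set \<Rightarrow> bool" where
  "closure_system C \<longleftrightarrow> (\<forall>A. A \<subseteq> C \<longrightarrow> Inf A \<in> C)"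

definition S_closure_system ::
  "(('a::complete_lattice \<Rightarrow> 'a) \<times> ('a \<Rightarrow> 'a)) set \<Rightarrow> 'a set \<Rightarrow> bool" where
  "S_closure_system S C \<longleftrightarrow> closure_system C \<and> (\<forall>(f, h)\<in>S. \<forall>a\<in>C. h a \<in> C)"

end

theory Submission imports Defs begin

text \<open>
  Let \<open>D\<close> be the set of all \<open>h b\<close> with \<open>b \<in> C\<close> and \<open>(f, h) \<in> S\<close>. Because \<open>(id, id) \<in> S\<close>, we
  have \<open>C \<subseteq> D\<close>, so \<open>C\<close> is an \<open>S\<close>-closure system iff it contains the infimum of every subset of
  \<open>D\<close>. It suffices to test the subsets \<open>{x \<in> D. a \<le> x}\<close>, since for \<open>a = Inf A\<close> this one
  includes \<open>A\<close> and has the same infimum.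
\<close>

lemma Inf_above_Inf_subset:
  fixes A D :: "'a::complete_lattice set"
  assumes "A \<subseteq> D"
  shows "Inf {x \<in> D. Inf A \<le> x} = Inf A"
proof (rule antisym)
  have "A \<subseteq> {x \<in> D. Inf A \<le> x}"
    using assms by (auto intro: Inf_lower)
  then show "Inf {x \<in> D. Inf A \<le> x} \<le> Inf A"
    by (rule Inf_superset_mono)
  show "Inf A \<le> Inf {x \<in> D. Inf A \<le> x}"
    by (rule Inf_greatest) simp
qed

lemma all_subset_Inf_mem_iff_all_above:
  fixes C D :: "'a::complete_lattice set"
  shows "(\<forall>A\<subseteq>D. Inf A \<in> C) \<longleftrightarrow> (\<forall>a. Inf {x \<in> D. a \<le> x} \<in> C)"
proof
  assume "\<forall>A\<subseteq>D. Inf A \<in> C"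
  then show "\<forall>a. Inf {x \<in> D. a \<le> x} \<in> C"
    by simp
next
  assume above: "\<forall>a. Inf {x \<in> D. a \<le> x} \<in> C"
  show "\<forall>A\<subseteq>D. Inf A \<in> C"
  proof (intro allI impI)
    fix A assume "A \<subseteq> D"
    from above have "Inf {x \<in> D. Inf A \<le> x} \<in> C" ..
    with \<open>A \<subseteq> D\<close> show "Inf A \<in> C"
      by (simp only: Inf_above_Inf_subset)
  qed
qed

lemma closure_system_and_superset_iff:
  fixes C D :: "'a::complete_lattice set"
  assumes "C \<subseteq> D"
  shows "closure_system C \<and> D \<subseteq> C \<longleftrightarrow> (\<forall>A\<subseteq>D. Inf A \<in> C)"
proof
  assume "closure_system C \<and> D \<subseteq> C"
  then show "\<forall>A\<subseteq>D. Inf A \<in> C"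
    by (auto simp: closure_system_def)
next
  assume Inf_mem: "\<forall>A\<subseteq>D. Inf A \<in> C"
  then have "closure_system C"
    using assms by (auto simp: closure_system_def)
  moreover have "D \<subseteq> C"
  proof
    fix d assume "d \<in> D"
    with Inf_mem have "Inf {d} \<in> C" by blast
    then show "d \<in> C" by simp
  qed
  ultimately show "closure_system C \<and> D \<subseteq> C" ..
qed

definition upper_adjoint_images :: "(('a \<Rightarrow> 'b) \<times> ('b \<Rightarrow> 'a)) set \<Rightarrow> 'b set \<Rightarrow> 'a set" where
  "upper_adjoint_images S C = {h b | f h b. b \<in> C \<and> (f, h) \<in> S}"

lemma subset_upper_adjoint_images:
  assumes "(id, id) \<in> S"
  shows "C \<subseteq> upper_adjoint_images S C"
proof
  fix b assume "b \<in> C"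
  with assms have "id b \<in> upper_adjoint_images S C"
    unfolding upper_adjoint_images_def by blast
  then show "b \<in> upper_adjoint_images S C" by simp
qed

lemma S_closure_system_iff_upper_adjoint_images_subset:
  "S_closure_system S C \<longleftrightarrow> closure_system C \<and> upper_adjoint_images S C \<subseteq> C"
  by (auto simp: S_closure_system_def upper_adjoint_images_def)

theorem theorem41:
  fixes S :: "(('a::complete_lattice \<Rightarrow> 'a) \<times> ('a \<Rightarrow> 'a)) set"
    and C :: "'a set"
  assumes "L_parameterization S"
  shows "S_closure_system S C \<longleftrightarrow>
    (\<forall>a. Inf {h b | f h b. a \<le> h b \<and> b \<in> C \<and> (f, h) \<in> S} \<in> C)"
proof -
  let ?D = "upper_adjoint_images S C"
  have "C \<subseteq> ?D"
    using assms by (simp add: L_parameterization_def subset_upper_adjoint_images)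
  have images_above: "{h b | f h b. a \<le> h b \<and> b \<in> C \<and> (f, h) \<in> S} = {x \<in> ?D. a \<le> x}" for a
    by (auto simp: upper_adjoint_images_def)
  have "S_closure_system S C \<longleftrightarrow> closure_system C \<and> ?D \<subseteq> C"
    by (rule S_closure_system_iff_upper_adjoint_images_subset)
  also have "\<dots> \<longleftrightarrow> (\<forall>A\<subseteq>?D. Inf A \<in> C)"
    using \<open>C \<subseteq> ?D\<close> by (rule closure_system_and_superset_iff)
  also have "\<dots> \<longleftrightarrow> (\<forall>a. Inf {x \<in> ?D. a \<le> x} \<in> C)"
    by (rule all_subset_Inf_mem_iff_all_above)
  finally show ?thesis
    by (simp only: images_above)
qed

end
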